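(* Let $d=(d^1,\dots,d^T)$ be a demand sequence on $k$ vertices with average drift $\delta\le 1$, i.e. $\sum_{t=2}^T\frac12\|d^t-d^{t-1}\|_1=\delta T$. (1) If the costs are $\ell_{ij}=1$ for all $i\ne j$, then the algorithm $\mathrm{match}$ (setting supply equal to demand, $s^t=d^t$ for all $t\ge1$) gives social welfare $(1-\delta)T$, and is $(1-\delta)$-competitive. (2) For an arbitrary metric $\ell_{ij}$ with $\ell_{ij}\le\ell_{\max}$ for all $i,j$, the $\mathrm{match}$ algorithm has social welfare at least $(1-\delta\ell_{\max})T$, and is $(1-\delta\ell_{\max})$-competitive.
   Context: $V$ is a set of $k$ vertices with distances $\ell_{ij}$ ($\ell_{ii}=0$). Time steps are $1,\dots,T$. Demand sequences $d=(d^1,\dots,d^T)$ and supply sequences $s=(s^1,\dots,s^T)$ consist of nonnegative vectors indexed by $V$ with entries summing to $1$. The demand served at time $t$ is $\mathrm{ds}(s^t,d^t)=\sum_i\min(s^t_i,d^t_i)$. The earthmover distance $\mathrm{em}(s,s')$ is the minimum of $\sum_{u,v}f(u,v)\ell_{uv}$ over all $f\ge 0$ with $\sum_v f(u,v)=s_u$, $\sum_u f(u,v)=s'_v$. The social welfare is $\mathrm{sw}(s,d)=\sum_{t=1}^T\mathrm{ds}(s^t,d^t)-\sum_{t=2}^T\mathrm{em}(s^{t-1},s^t)$. An algorithm producing supply sequence $s$ is $c$-competitive on $d$ if $\mathrm{sw}(s,d)\ge c\cdot\max_{\tilde s}\mathrm{sw}(\tilde s,d)$.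
   Formalization: In (2), the competitiveness claim is made only when δ·ℓ_max ≤ 1 (nonnegative ratio); without this it is false, e.g. k=2, T=2, d¹=e₁, d²=e₂, ℓ₁₂=ℓ_max=4, where match has welfare −2 < −1·OPT = −1. *)

theory Defs
  imports "HOL-Analysis.Analysis"
begin

text \<open>
  The vertex set is the universe of a finite type \<open>'v\<close>, so the number of vertices is \<open>CARD('v)\<close>.
  Sequences are indexed by \<open>nat\<close>; only the entries at the time steps \<open>1, \<dots>, T\<close> are relevant.
\<close>

definition distribution :: "real ^ 'v::finite \<Rightarrow> bool" where
  "distribution x \<longleftrightarrow> (\<forall>i. 0 \<le> x $ i) \<and> (\<Sum>i\<in>UNIV. x $ i) = 1"

definition distribution_seq :: "nat \<Rightarrow> (nat \<Rightarrow> real ^ 'v::finite) \<Rightarrow> bool" where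
  "distribution_seq T x \<longleftrightarrow> (\<forall>t\<in>{1..T}. distribution (x t))"

definition demand_served :: "real ^ 'v::finite \<Rightarrow> real ^ 'v \<Rightarrow> real" where
  "demand_served s d = (\<Sum>i\<in>UNIV. min (s $ i) (d $ i))"

definition transport_plan :: "real ^ 'v::finite \<Rightarrow> real ^ 'v \<Rightarrow> ('v \<Rightarrow> 'v \<Rightarrow> real) \<Rightarrow> bool" where
  "transport_plan s s' f \<longleftrightarrow>
     (\<forall>u v. 0 \<le> f u v) \<and>
     (\<forall>u. (\<Sum>v\<in>UNIV. f u v) = s $ u) \<and>
     (\<forall>v. (\<Sum>u\<in>UNIV. f u v) = s' $ v)"

text \<open>
  For distributions \<open>s\<close> and \<open>s'\<close> the transport plans form a nonempty compact set on which the
  cost is continuous, so the infimum below is a minimum.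
\<close>

definition earthmover :: "('v::finite \<Rightarrow> 'v \<Rightarrow> real) \<Rightarrow> real ^ 'v \<Rightarrow> real ^ 'v \<Rightarrow> real" where
  "earthmover l s s' =
     (INF f\<in>{f. transport_plan s s' f}. \<Sum>u\<in>UNIV. \<Sum>v\<in>UNIV. f u v * l u v)"

definition social_welfare ::
  "('v::finite \<Rightarrow> 'v \<Rightarrow> real) \<Rightarrow> nat \<Rightarrow> (nat \<Rightarrow> real ^ 'v) \<Rightarrow> (nat \<Rightarrow> real ^ 'v) \<Rightarrow> real" where
  "social_welfare l T s d =
     (\<Sum>t=1..T. demand_served (s t) (d t)) - (\<Sum>t=2..T. earthmover l (s (t - 1)) (s t))"

text \<open>The supremum is attained, again by compactness, for every nonnegative \<open>l\<close>.\<close>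

definition optimal_welfare ::
  "('v::finite \<Rightarrow> 'v \<Rightarrow> real) \<Rightarrow> nat \<Rightarrow> (nat \<Rightarrow> real ^ 'v) \<Rightarrow> real" where
  "optimal_welfare l T d = (SUP s\<in>{s. distribution_seq T s}. social_welfare l T s d)"

text \<open>An algorithm is a map from demand sequences to supply sequences.\<close>

definition competitive_on ::
  "('v::finite \<Rightarrow> 'v \<Rightarrow> real) \<Rightarrow> nat \<Rightarrow> real \<Rightarrow> ((nat \<Rightarrow> real ^ 'v) \<Rightarrow> nat \<Rightarrow> real ^ 'v) \<Rightarrow>
   (nat \<Rightarrow> real ^ 'v) \<Rightarrow> bool" where
  "competitive_on l T c alg d \<longleftrightarrow> social_welfare l T (alg d) d \<ge> c * optimal_welfare l T d"

definition match_alg :: "(nat \<Rightarrow> real ^ 'v::finite) \<Rightarrow> nat \<Rightarrow> real ^ 'v" where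
  "match_alg d = (\<lambda>t. d t)"

end

theory Submission
  imports Defs
begin

text \<open>
  Transport plans that leave the common part \<open>min (s u) (s' u)\<close> in place and redistribute only the
  excess move exactly half the \<open>L1\<close> distance, each unit at cost at most \<open>lmax\<close>. No plan can keep more
  than \<open>min (s u) (s' u)\<close> at \<open>u\<close>, so for unit costs this is optimal. Matching serves
  all the demand, and no sequence has welfare exceeding \<open>T\<close>.
\<close>

text \<open>Both vectors have total mass 1, so the positive and the negative part of their
  difference carry the same mass, half of the L1 norm each. Pointwise this is the usual way of
  writing \<open>max\<close> and \<open>min\<close> through the absolute value.\<close>

lemma half_l1_excess:
  assumes "distribution s" "distribution s'"
  shows "(\<Sum>u\<in>UNIV. max 0 (s $ u - s' $ u)) = 1/2 * (\<Sum>i\<in>UNIV. \<bar>s' $ i - s $ i\<bar>)"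
    and "(\<Sum>u\<in>UNIV. max 0 (s' $ u - s $ u)) = 1/2 * (\<Sum>i\<in>UNIV. \<bar>s' $ i - s $ i\<bar>)"
    and "(\<Sum>u\<in>UNIV. min (s $ u) (s' $ u)) = 1 - 1/2 * (\<Sum>i\<in>UNIV. \<bar>s' $ i - s $ i\<bar>)"
proof -
  have sums: "(\<Sum>i\<in>UNIV. s $ i) = 1" "(\<Sum>i\<in>UNIV. s' $ i) = 1"
    using assms by (auto simp: distribution_def)
  have "max 0 (s $ u - s' $ u) = 1/2 * (s $ u - s' $ u + \<bar>s' $ u - s $ u\<bar>)"
    "max 0 (s' $ u - s $ u) = 1/2 * (s' $ u - s $ u + \<bar>s' $ u - s $ u\<bar>)"
    "min (s $ u) (s' $ u) = 1/2 * (s $ u + s' $ u - \<bar>s' $ u - s $ u\<bar>)" for u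
    by (simp_all add: max_def min_def abs_if field_simps)
  then show "(\<Sum>u\<in>UNIV. max 0 (s $ u - s' $ u)) = 1/2 * (\<Sum>i\<in>UNIV. \<bar>s' $ i - s $ i\<bar>)"
    "(\<Sum>u\<in>UNIV. max 0 (s' $ u - s $ u)) = 1/2 * (\<Sum>i\<in>UNIV. \<bar>s' $ i - s $ i\<bar>)"
    "(\<Sum>u\<in>UNIV. min (s $ u) (s' $ u)) = 1 - 1/2 * (\<Sum>i\<in>UNIV. \<bar>s' $ i - s $ i\<bar>)"
    by (simp_all only: sum_distrib_left[symmetric] sum.distrib sum_subtractf sums)
       (simp_all add: field_simps)
qed

text \<open>The surplus at \<open>u\<close> is spread over all deficits in proportion to their size.
  Total surplus and total deficit both equal \<open>D\<close>, so dividing the product by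
  \<open>D\<close> gives the right marginals.\<close>

lemma excess_transport_plan:
  assumes "distribution s" "distribution s'"
  defines "D \<equiv> 1/2 * (\<Sum>i\<in>UNIV. \<bar>s' $ i - s $ i\<bar>)"
  shows "transport_plan s s' (\<lambda>u v. (if u = v then min (s $ u) (s' $ u) else 0)
           + max 0 (s $ u - s' $ u) * max 0 (s' $ v - s $ v) / D)"
    (is "transport_plan s s' (\<lambda>u v. ?g u v + ?a u * ?b v / D)")
proof -
  have a: "(\<Sum>u\<in>UNIV. ?a u) = D" and b: "(\<Sum>v\<in>UNIV. ?b v) = D"
    unfolding D_def using half_l1_excess[OF assms(1,2)] by auto
  have pos: "D \<ge> 0" "\<And>u. 0 \<le> s $ u" "\<And>u. 0 \<le> s' $ u"
    using assms(1,2) by (auto simp: D_def distribution_def intro!: sum_nonneg)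
  \<comment> \<open>Division by \<open>D = 0\<close> yields 0; the marginals survive because then
    every surplus and deficit vanishes, being nonnegative with sum 0.\<close>
  have excess_zero: "?a u = 0" "?b u = 0" if "D = 0" for u
    using a b that by (simp_all add: sum_nonneg_eq_0_iff)
  have cancel_a: "?a u * D / D = ?a u" and cancel_b: "D * ?b u / D = ?b u" for u
    using excess_zero[of u] by (cases "D = 0"; simp)+
  have g: "(\<Sum>v\<in>UNIV. ?g u v) = min (s $ u) (s' $ u)"
    "(\<Sum>v\<in>UNIV. ?g v u) = min (s $ u) (s' $ u)" for u
    by simp_all
  show ?thesis
    unfolding transport_plan_def
  proof (intro conjI allI)
    show "0 \<le> ?g u v + ?a u * ?b v / D" for u v
      using pos by (intro add_nonneg_nonneg divide_nonneg_nonneg mult_nonneg_nonneg) auto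
    show "(\<Sum>v\<in>UNIV. ?g u v + ?a u * ?b v / D) = s $ u" for u
    proof -
      have "(\<Sum>v\<in>UNIV. ?g u v + ?a u * ?b v / D) = min (s $ u) (s' $ u) + ?a u * D / D"
        by (simp only: sum.distrib g sum_divide_distrib[symmetric] sum_distrib_left[symmetric] b)
      \<comment> \<open>What stays plus what leaves is everything:
        \<open>min x y + max 0 (x - y) = x\<close>.\<close>
      then show ?thesis unfolding cancel_a by linarith
    qed
    show "(\<Sum>u\<in>UNIV. ?g u v + ?a u * ?b v / D) = s' $ v" for v
    proof -
      have "(\<Sum>u\<in>UNIV. ?g u v + ?a u * ?b v / D) = min (s $ v) (s' $ v) + D * ?b v / D"
        by (simp only: sum.distrib g sum_divide_distrib[symmetric] sum_distrib_right[symmetric] a)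
      then show ?thesis unfolding cancel_b by linarith
    qed
  qed
qed

text \<open>A bound valid for every plan passes to the infimum only if some plan exists; the
  explicit plan above is that witness.\<close>

lemma earthmover_geI:
  assumes "distribution s" "distribution s'"
    and "\<And>f. transport_plan s s' f \<Longrightarrow> c \<le> (\<Sum>u\<in>UNIV. \<Sum>v\<in>UNIV. f u v * l u v)"
  shows "c \<le> earthmover l s s'"
  unfolding earthmover_def
  using excess_transport_plan[OF assms(1,2)] assms(3) by (intro cINF_greatest) auto

lemma transport_cost_nonneg:
  assumes "\<And>u v. 0 \<le> l u v" "transport_plan s s' f"
  shows "0 \<le> (\<Sum>u\<in>UNIV. \<Sum>v\<in>UNIV. f u v * l u v)"
  using assms by (intro sum_nonneg mult_nonneg_nonneg) (auto simp: transport_plan_def)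

lemma earthmover_nonneg:
  assumes "\<And>u v. 0 \<le> l u v" "distribution s" "distribution s'"
  shows "0 \<le> earthmover l s s'"
  using assms by (intro earthmover_geI transport_cost_nonneg)

text \<open>The infimum is at most the cost of the explicit plan, which moves mass \<open>D\<close>
  at a price of at most \<open>lmax\<close> per unit.\<close>

lemma earthmover_le_half_l1:
  assumes nonneg: "\<And>u v. 0 \<le> l u v" and refl: "\<And>u. l u u = 0" and le: "\<And>u v. l u v \<le> lmax"
    and "distribution s" "distribution s'"
  shows "earthmover l s s' \<le> lmax * (1/2 * (\<Sum>i\<in>UNIV. \<bar>s' $ i - s $ i\<bar>))"
proof -
  let ?a = "\<lambda>u. max 0 (s $ u - s' $ u)" and ?b = "\<lambda>u. max 0 (s' $ u - s $ u)"
  define D where "D = 1/2 * (\<Sum>i\<in>UNIV. \<bar>s' $ i - s $ i\<bar>)"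
  let ?f = "\<lambda>u v. (if u = v then min (s $ u) (s' $ u) else 0) + ?a u * ?b v / D"
  have a: "(\<Sum>u\<in>UNIV. ?a u) = D" and b: "(\<Sum>v\<in>UNIV. ?b v) = D"
    unfolding D_def using half_l1_excess[OF assms(4,5)] by auto
  have "D \<ge> 0"
    by (auto simp: D_def intro!: sum_nonneg)
  \<comment> \<open>Over the reals an infimum lies below its members only once the set is known to
    be bounded below; 0 serves as the bound.\<close>
  have "bdd_below ((\<lambda>f. \<Sum>u\<in>UNIV. \<Sum>v\<in>UNIV. f u v * l u v) ` {f. transport_plan s s' f})"
    using transport_cost_nonneg[OF nonneg] by (intro bdd_belowI2[where m = 0]) auto
  then have "earthmover l s s' \<le> (\<Sum>u\<in>UNIV. \<Sum>v\<in>UNIV. ?f u v * l u v)"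
    unfolding earthmover_def
    using excess_transport_plan[OF assms(4,5)]
    by (intro cINF_lower) (simp_all add: D_def)
  also have "\<dots> \<le> (\<Sum>u\<in>UNIV. \<Sum>v\<in>UNIV. ?a u * (?b v * (lmax / D)))"
  proof (intro sum_mono)
    fix u v
    \<comment> \<open>The mass kept in place sits on the diagonal, where \<open>l\<close> is
      0.\<close>
    have "?f u v * l u v = ?a u * ?b v / D * l u v"
      using refl by (cases "u = v") auto
    also have "\<dots> \<le> ?a u * ?b v / D * lmax"
      using \<open>D \<ge> 0\<close> by (intro mult_left_mono le divide_nonneg_nonneg mult_nonneg_nonneg) auto
    finally show "?f u v * l u v \<le> ?a u * (?b v * (lmax / D))"
      by simp
  qed
  \<comment> \<open>The bound is a product of a factor in \<open>u\<close> and a factor in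
    \<open>v\<close>, so the double sum splits into total surplus times total deficit. The
    cancellation that follows also holds for \<open>D = 0\<close>, where both sides are 0.\<close>
  also have "\<dots> = D * (D * (lmax / D))"
    by (simp only: sum_distrib_left[symmetric] sum_distrib_right[symmetric] a b)
  also have "\<dots> = lmax * D"
    by simp
  finally show ?thesis
    by (simp add: D_def)
qed

text \<open>With unit costs a plan pays exactly for its off-diagonal mass, which is 1 minus the mass
  on the diagonal.\<close>

lemma half_l1_le_earthmover_uniform:
  assumes refl: "\<And>u. l u u = 0" and unit: "\<And>u v. u \<noteq> v \<Longrightarrow> l u v = 1"
    and "distribution s" "distribution s'"
  shows "1/2 * (\<Sum>i\<in>UNIV. \<bar>s' $ i - s $ i\<bar>) \<le> earthmover l s s'"
proof (rule earthmover_geI[OF assms(3,4)])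
  fix f assume plan: "transport_plan s s' f"
  have "f u u \<le> min (s $ u) (s' $ u)" for u
  proof -
    \<comment> \<open>A diagonal entry lies in a row with sum \<open>s $ u\<close> and in a column
      with sum \<open>s' $ u\<close>.\<close>
    have "f u u \<le> (\<Sum>v\<in>UNIV. f u v)" "f u u \<le> (\<Sum>v\<in>UNIV. f v u)"
      using plan member_le_sum[of u UNIV "f u"] member_le_sum[of u UNIV "\<lambda>v. f v u"]
      by (simp_all add: transport_plan_def)
    then show ?thesis
      using plan by (simp add: transport_plan_def)
  qed
  then have "1/2 * (\<Sum>i\<in>UNIV. \<bar>s' $ i - s $ i\<bar>) \<le> 1 - (\<Sum>u\<in>UNIV. f u u)"
    using half_l1_excess(3)[OF assms(3,4)] sum_mono[of UNIV "\<lambda>u. f u u" "\<lambda>u. min (s $ u) (s' $ u)"]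
    by simp
  also have "\<dots> = (\<Sum>u\<in>UNIV. \<Sum>v\<in>UNIV. f u v) - (\<Sum>u\<in>UNIV. f u u)"
    using plan assms(3) by (simp add: transport_plan_def distribution_def)
  \<comment> \<open>Removing the diagonal inside the double sum leaves weight 0 for
    \<open>u = v\<close> and weight 1 elsewhere, which is \<open>l u v\<close>.\<close>
  also have "\<dots> = (\<Sum>u\<in>UNIV. \<Sum>v\<in>UNIV. f u v - (if u = v then f u v else 0))"
    by (simp add: sum_subtractf)
  also have "\<dots> = (\<Sum>u\<in>UNIV. \<Sum>v\<in>UNIV. f u v * l u v)"
    using refl unit by (intro sum.cong) auto
  finally show "1/2 * (\<Sum>i\<in>UNIV. \<bar>s' $ i - s $ i\<bar>) \<le> \<dots>" .
qed

lemma distribution_seqD: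
  assumes "distribution_seq T x" "t \<in> {2..T}"
  shows "distribution (x (t - 1))" "distribution (x t)"
  using assms unfolding distribution_seq_def by (auto elim!: ballE)

lemma demand_served_le_1:
  assumes "distribution s"
  shows "demand_served s d \<le> 1"
proof -
  have "demand_served s d \<le> (\<Sum>i\<in>UNIV. s $ i)"
    unfolding demand_served_def by (intro sum_mono) simp
  with assms show ?thesis by (simp add: distribution_def)
qed

lemma social_welfare_le:
  assumes "\<And>u v. 0 \<le> l u v" "distribution_seq T s"
  shows "social_welfare l T s d \<le> real T"
proof -
  have "(\<Sum>t=1..T. demand_served (s t) (d t)) \<le> (\<Sum>t=1..T. 1)"
    using assms(2) by (intro sum_mono demand_served_le_1) (auto simp: distribution_seq_def)
  moreover have "0 \<le> (\<Sum>t=2..T. earthmover l (s (t - 1)) (s t))"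
    using distribution_seqD[OF assms(2)] by (intro sum_nonneg earthmover_nonneg assms(1))
  ultimately show ?thesis
    by (simp add: social_welfare_def)
qed

lemma optimal_welfare_le:
  fixes d :: "nat \<Rightarrow> real ^ 'v::finite"
  assumes "\<And>u v. 0 \<le> l u v" "distribution_seq T d"
  shows "optimal_welfare l T d \<le> real T"
  unfolding optimal_welfare_def
  \<comment> \<open>The supremum needs a feasible supply sequence; \<open>d\<close> itself is
    one.\<close>
  using assms by (intro cSUP_least social_welfare_le) auto

lemma social_welfare_match:
  assumes "distribution_seq T d"
  shows "social_welfare l T (match_alg d) d = real T - (\<Sum>t=2..T. earthmover l (d (t - 1)) (d t))"
proof -
  have "(\<Sum>t=1..T. demand_served (d t) (d t)) = (\<Sum>t=1..T. 1)"
    using assms by (intro sum.cong) (auto simp: demand_served_def distribution_seq_def distribution_def)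
  then show ?thesis
    by (simp add: social_welfare_def match_alg_def)
qed

lemma social_welfare_match_ge:
  assumes "\<And>u v. 0 \<le> l u v" "\<And>u. l u u = 0" "\<And>u v. l u v \<le> lmax" "distribution_seq T d"
    and drift: "(\<Sum>t=2..T. (1/2) * (\<Sum>i\<in>UNIV. \<bar>d t $ i - d (t - 1) $ i\<bar>)) = \<delta> * real T"
  shows "(1 - \<delta> * lmax) * real T \<le> social_welfare l T (match_alg d) d"
proof -
  have "(\<Sum>t=2..T. earthmover l (d (t - 1)) (d t))
      \<le> (\<Sum>t=2..T. lmax * (1/2 * (\<Sum>i\<in>UNIV. \<bar>d t $ i - d (t - 1) $ i\<bar>)))"
    using distribution_seqD[OF assms(4)] by (intro sum_mono earthmover_le_half_l1 assms(1-3))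
  also have "\<dots> = lmax * (\<delta> * real T)"
    by (simp only: sum_distrib_left[symmetric] drift[symmetric])
  finally show ?thesis
    unfolding social_welfare_match[OF assms(4)] by (simp add: algebra_simps)
qed

text \<open>The optimum is compared with \<open>real T\<close> only; a nonnegative \<open>c\<close>
  lets the bound on the optimum be multiplied by \<open>c\<close>.\<close>

lemma competitive_onI:
  fixes d :: "nat \<Rightarrow> real ^ 'v::finite"
  assumes "\<And>u v. 0 \<le> l u v" "distribution_seq T d" "0 \<le> c"
    and "c * real T \<le> social_welfare l T (alg d) d"
  shows "competitive_on l T c alg d"
  unfolding competitive_on_def
  using optimal_welfare_le[OF assms(1,2)] assms(3,4) by (meson mult_left_mono order_trans)

theorem theorem5p13:
  fixes d :: "nat \<Rightarrow> real ^ 'v::finite" and T :: nat and \<delta> :: real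
  assumes "distribution_seq T d"
    and "(\<Sum>t=2..T. (1/2) * (\<Sum>i\<in>UNIV. \<bar>d t $ i - d (t - 1) $ i\<bar>)) = \<delta> * real T"
    and "\<delta> \<le> 1"
  shows "(\<forall>l :: 'v \<Rightarrow> 'v \<Rightarrow> real.
            (\<forall>i. l i i = 0) \<and> (\<forall>i j. i \<noteq> j \<longrightarrow> l i j = 1) \<longrightarrow>
              social_welfare l T (match_alg d) d = (1 - \<delta>) * real T \<and>
              competitive_on l T (1 - \<delta>) match_alg d) \<and>
         (\<forall>(l :: 'v \<Rightarrow> 'v \<Rightarrow> real) (lmax :: real).
            Metric_space UNIV l \<and> (\<forall>i j. l i j \<le> lmax) \<longrightarrow>
              social_welfare l T (match_alg d) d \<ge> (1 - \<delta> * lmax) * real T \<and>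
              (\<delta> * lmax \<le> 1 \<longrightarrow> competitive_on l T (1 - \<delta> * lmax) match_alg d))"
proof (intro conjI allI impI; (elim conjE)?)
  fix l :: "'v \<Rightarrow> 'v \<Rightarrow> real"
  assume refl: "\<forall>i. l i i = 0" and unit: "\<forall>i j. i \<noteq> j \<longrightarrow> l i j = 1"
  have bounds: "0 \<le> l u v" "l u v \<le> 1" for u v
    using refl unit by (cases "u = v"; simp)+
  \<comment> \<open>Unit costs are the case \<open>lmax = 1\<close> of the general bound.\<close>
  have ge: "(1 - \<delta>) * real T \<le> social_welfare l T (match_alg d) d"
    using social_welfare_match_ge[where l = l and lmax = 1, OF bounds(1) _ bounds(2) assms(1,2)] refl
    by simp
  \<comment> \<open>For equality the movement cost is also bounded from below by the drift, step by
    step.\<close>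
  have "\<delta> * real T \<le> (\<Sum>t=2..T. earthmover l (d (t - 1)) (d t))"
    unfolding assms(2)[symmetric] using distribution_seqD[OF assms(1)] refl unit
    by (intro sum_mono half_l1_le_earthmover_uniform) auto
  with ge show "social_welfare l T (match_alg d) d = (1 - \<delta>) * real T"
    unfolding social_welfare_match[OF assms(1)] by (simp add: algebra_simps)
  show "competitive_on l T (1 - \<delta>) match_alg d"
    using bounds(1) assms(1,3) ge by (intro competitive_onI) auto
next
  fix l :: "'v \<Rightarrow> 'v \<Rightarrow> real" and lmax :: real
  assume metric: "Metric_space UNIV l" and le: "\<forall>i j. l i j \<le> lmax"
  have nonneg: "0 \<le> l u v" and refl: "l u u = 0" for u v
    using metric by (simp_all add: Metric_space_def)
  show ge: "(1 - \<delta> * lmax) * real T \<le> social_welfare l T (match_alg d) d"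
    using social_welfare_match_ge[where l = l, OF nonneg refl _ assms(1,2)] le by simp
  \<comment> \<open>This makes the competitive ratio nonnegative, as \<open>competitive_onI\<close>
    requires.\<close>
  assume "\<delta> * lmax \<le> 1"
  then show "competitive_on l T (1 - \<delta> * lmax) match_alg d"
    using nonneg assms(1) ge by (intro competitive_onI) auto
qed

end
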